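(* Let $\mathcal{H}\neq0$ be a finite dimensional complex Hilbert space, $J$ an antiunitary operator in $\mathcal{H}$ with $J^2=1$, and $\mathcal{A}$ a (unital) involutive algebra over $\mathbb{R}$ of operators in $\mathcal{H}$ such that $[x,y^0]=0$ for all $x,y\in\mathcal{A}$, and such that (1) the action of $\mathcal{A}$ has a separating vector and (2) the representation of $\mathcal{A}$ and $J$ in $\mathcal{H}$ is irreducible. Then one of the following cases holds: - the center $Z(\mathcal{A}_{\mathbb{C}})$ is reduced to $\mathbb{C}$; - one has $Z(\mathcal{A}_{\mathbb{C}})=\mathbb{C}\oplus\mathbb{C}$ and $Je_1J^{-1}=e_2$, where $e_1,e_2\in Z(\mathcal{A}_{\mathbb{C}})$ are the minimal projections of $Z(\mathcal{A}_{\mathbb{C}})$.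
   Context: For an operator $x$ in $\mathcal{H}$, $x^0=Jx^*J^{-1}$. Condition (1) means there is $\xi\in\mathcal{H}$ with $\mathcal{A}'\xi=\mathcal{H}$, where $\mathcal{A}'$ is the commutant of $\mathcal{A}$. Condition (2) means that no non-trivial (i.e. $\neq0,1$) projection $e\in\mathcal{L}(\mathcal{H})$ commutes with $\mathcal{A}$ and $J$. $\mathcal{A}_{\mathbb{C}}$ denotes the complex linear span of $\mathcal{A}$ in the algebra $\mathcal{L}(\mathcal{H})$ of all operators in $\mathcal{H}$. *)

theory Defs
  imports Complex_Main "HOL-Library.Function_Algebras"
begin

(* Inner products are antilinear in the first argument. Completeness is not an axiom: the theorem
   concerns finite dimensional spaces, where it is automatic. *)
class complex_inner = ab_group_add +
  fixes scaleC :: "complex \<Rightarrow> 'a \<Rightarrow> 'a" (infixr "*\<^sub>C" 75)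
    and cinner :: "'a \<Rightarrow> 'a \<Rightarrow> complex"
  assumes scaleC_add_right: "a *\<^sub>C (x + y) = a *\<^sub>C x + a *\<^sub>C y"
    and scaleC_add_left: "(a + b) *\<^sub>C x = a *\<^sub>C x + b *\<^sub>C x"
    and scaleC_scaleC: "a *\<^sub>C (b *\<^sub>C x) = (a * b) *\<^sub>C x"
    and scaleC_one: "1 *\<^sub>C x = x"
    and cinner_commute: "cinner x y = cnj (cinner y x)"
    and cinner_add_right: "cinner x (y + z) = cinner x y + cinner x z"
    and cinner_scaleC_right: "cinner x (a *\<^sub>C y) = a * cinner x y"
    and cinner_ge_zero: "0 \<le> Re (cinner x x)"
    and cinner_eq_zero_iff: "cinner x x = 0 \<longleftrightarrow> x = 0"

interpretation complex_vector: vector_space "scaleC :: complex \<Rightarrow> 'a \<Rightarrow> 'a::complex_inner"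
  by unfold_locales (simp_all add: scaleC_add_right scaleC_add_left scaleC_scaleC scaleC_one)

abbreviation clinear :: "('h::complex_inner \<Rightarrow> 'h) \<Rightarrow> bool" where
  "clinear \<equiv> Vector_Spaces.linear scaleC scaleC"

(* Operators are functions with the pointwise + and 0 of Function_Algebras. The product of operators
   is composition and the unit is id; the pointwise * and 1 of Function_Algebras are never used. *)
definition scale_op :: "complex \<Rightarrow> ('h::complex_inner \<Rightarrow> 'h) \<Rightarrow> 'h \<Rightarrow> 'h" where
  "scale_op c x = (\<lambda>u. c *\<^sub>C x u)"

interpretation op_vector: vector_space "scale_op :: complex \<Rightarrow> ('h::complex_inner \<Rightarrow> 'h) \<Rightarrow> _"
  by unfold_locales
    (simp_all add: scale_op_def fun_eq_iff scaleC_add_right scaleC_add_left scaleC_scaleC scaleC_one)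

(* On a finite dimensional space every linear x has exactly one adjoint. *)
definition cadjoint :: "('h::complex_inner \<Rightarrow> 'h) \<Rightarrow> 'h \<Rightarrow> 'h" where
  "cadjoint x = (THE y. clinear y \<and> (\<forall>u v. cinner (y u) v = cinner u (x v)))"

definition antiunitary :: "('h::complex_inner \<Rightarrow> 'h) \<Rightarrow> bool" where
  "antiunitary J \<longleftrightarrow>
     (\<forall>u v. J (u + v) = J u + J v) \<and>
     (\<forall>c u. J (c *\<^sub>C u) = cnj c *\<^sub>C J u) \<and>
     bij J \<and>
     (\<forall>u v. cinner (J u) (J v) = cinner v u)"

definition opposite :: "('h::complex_inner \<Rightarrow> 'h) \<Rightarrow> ('h \<Rightarrow> 'h) \<Rightarrow> 'h \<Rightarrow> 'h" where
  "opposite J x = J \<circ> cadjoint x \<circ> inv J"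

definition real_involutive_algebra :: "('h::complex_inner \<Rightarrow> 'h) set \<Rightarrow> bool" where
  "real_involutive_algebra A \<longleftrightarrow>
     (\<forall>x\<in>A. clinear x) \<and>
     id \<in> A \<and>
     (\<forall>x\<in>A. \<forall>y\<in>A. x + y \<in> A) \<and>
     (\<forall>r::real. \<forall>x\<in>A. scale_op (complex_of_real r) x \<in> A) \<and>
     (\<forall>x\<in>A. \<forall>y\<in>A. x \<circ> y \<in> A) \<and>
     (\<forall>x\<in>A. cadjoint x \<in> A)"

definition commutant :: "('h::complex_inner \<Rightarrow> 'h) set \<Rightarrow> ('h \<Rightarrow> 'h) set" where
  "commutant A = {x. clinear x \<and> (\<forall>a\<in>A. x \<circ> a = a \<circ> x)}"

definition has_separating_vector :: "('h::complex_inner \<Rightarrow> 'h) set \<Rightarrow> bool" where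
  "has_separating_vector A \<longleftrightarrow> (\<exists>\<xi>. (\<lambda>x. x \<xi>) ` commutant A = UNIV)"

definition is_projection :: "('h::complex_inner \<Rightarrow> 'h) \<Rightarrow> bool" where
  "is_projection e \<longleftrightarrow> clinear e \<and> e \<circ> e = e \<and> cadjoint e = e"

definition irreducible_rep :: "('h::complex_inner \<Rightarrow> 'h) set \<Rightarrow> ('h \<Rightarrow> 'h) \<Rightarrow> bool" where
  "irreducible_rep A J \<longleftrightarrow>
     \<not> (\<exists>e. is_projection e \<and> e \<noteq> 0 \<and> e \<noteq> id \<and>
           (\<forall>a\<in>A. e \<circ> a = a \<circ> e) \<and> e \<circ> J = J \<circ> e)"

abbreviation complexification :: "('h::complex_inner \<Rightarrow> 'h) set \<Rightarrow> ('h \<Rightarrow> 'h) set" where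
  "complexification \<equiv> op_vector.span"

definition op_center :: "('h \<Rightarrow> 'h) set \<Rightarrow> ('h \<Rightarrow> 'h) set" where
  "op_center B = {z \<in> B. \<forall>x\<in>B. z \<circ> x = x \<circ> z}"

definition is_C_plus_C :: "('h::complex_inner \<Rightarrow> 'h) set \<Rightarrow> bool" where
  "is_C_plus_C Z \<longleftrightarrow>
     (\<exists>\<phi> :: complex \<times> complex \<Rightarrow> 'h \<Rightarrow> 'h.
        bij_betw \<phi> UNIV Z \<and>
        (\<forall>a b c d. \<phi> (a + c, b + d) = \<phi> (a, b) + \<phi> (c, d)) \<and>
        (\<forall>c a b. \<phi> (c * a, c * b) = scale_op c (\<phi> (a, b))) \<and>
        (\<forall>a b c d. \<phi> (a * c, b * d) = \<phi> (a, b) \<circ> \<phi> (c, d)) \<and>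
        \<phi> (1, 1) = id \<and>
        (\<forall>a b. \<phi> (cnj a, cnj b) = cadjoint (\<phi> (a, b))))"

(* f \<circ> e = f expresses f \<le> e in the usual order of projections. *)
definition minimal_projection_of :: "('h::complex_inner \<Rightarrow> 'h) set \<Rightarrow> ('h \<Rightarrow> 'h) \<Rightarrow> bool" where
  "minimal_projection_of Z e \<longleftrightarrow>
     e \<in> Z \<and> is_projection e \<and> e \<noteq> 0 \<and>
     (\<forall>f\<in>Z. is_projection f \<and> f \<circ> e = f \<longrightarrow> f = 0 \<or> f = e)"

end

theory Submission
  imports Defs "HOL-Computational_Algebra.Fundamental_Theorem_Algebra"
begin

text \<open>For a projection \<open>e\<close> of the center of the complexification, \<open>J e J\<close> is the opposite of \<open>e\<close>, so
  it commutes with \<open>A\<close>. Hence \<open>e J e J\<close> is a projection commuting with \<open>A\<close> and \<open>J\<close>; by irreducibility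
  it is \<open>1\<close>, and then \<open>e = 1\<close>, or \<open>0\<close>, and then \<open>e + J e J\<close> is again such a projection. So
  \<open>e \<in> {0, 1}\<close> or \<open>J e J = 1 - e\<close>. If \<open>e\<close> is of the last kind, every projection \<open>f \<le> e\<close> of the center
  is \<open>0\<close> or satisfies \<open>1 - f = J f J \<le> J e J = 1 - e\<close>, so \<open>f = e\<close>. The center
  thus has at most the projections \<open>0\<close>, \<open>e\<close>, \<open>1 - e\<close>, \<open>1\<close>, and it is spanned by the minimal ones.\<close>

section \<open>Operators and adjoints\<close>

lemma clinear_iff:
  "clinear x \<longleftrightarrow> (\<forall>u v. x (u + v) = x u + x v) \<and> (\<forall>c u. x (c *\<^sub>C u) = c *\<^sub>C x u)"
  by (auto simp: Vector_Spaces.linear_iff complex_vector.vector_space_axioms)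

lemma clinear_add: "clinear x \<Longrightarrow> x (u + v) = x u + x v"
  and clinear_scale: "clinear x \<Longrightarrow> x (c *\<^sub>C u) = c *\<^sub>C x u"
  by (simp_all add: clinear_iff)

lemma clinear_zero: "clinear x \<Longrightarrow> x 0 = 0"
  using clinear_scale[of x 0 0] by simp

lemma clinear_diff: "clinear x \<Longrightarrow> x (u - v) = x u - x v"
  by (metis add_diff_cancel_right' clinear_add diff_add_cancel)

lemma clinear_sum: "clinear x \<Longrightarrow> x (sum f S) = (\<Sum>i\<in>S. x (f i))"
  by (induction S rule: infinite_finite_induct) (simp_all add: clinear_zero clinear_add)

lemma clinear_id: "clinear id"
  and clinear_zero_op: "clinear 0"
  and clinear_plus: "clinear x \<Longrightarrow> clinear y \<Longrightarrow> clinear (x + y)"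
  and clinear_minus: "clinear x \<Longrightarrow> clinear y \<Longrightarrow> clinear (x - y)"
  and clinear_scale_op: "clinear x \<Longrightarrow> clinear (scale_op c x)"
  and clinear_comp: "clinear x \<Longrightarrow> clinear y \<Longrightarrow> clinear (x \<circ> y)"
  by (auto simp: clinear_iff scale_op_def algebra_simps scaleC_add_right scaleC_scaleC
      complex_vector.scale_right_diff_distrib)

lemma scale_op_apply: "scale_op c x u = c *\<^sub>C x u"
  by (simp add: scale_op_def)

lemma sum_op_apply: "(\<Sum>i\<in>S. f i) u = (\<Sum>i\<in>S. f i u)" for f :: "'i \<Rightarrow> 'h \<Rightarrow> 'h::complex_inner"
  by (induction S rule: infinite_finite_induct) simp_all

lemma scale_op_comp: "scale_op c x \<circ> y = scale_op c (x \<circ> y)"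
  by (simp add: fun_eq_iff scale_op_apply)

lemma comp_scale_op: "clinear x \<Longrightarrow> x \<circ> scale_op c y = scale_op c (x \<circ> y)"
  by (simp add: fun_eq_iff scale_op_apply clinear_scale)

lemma
  fixes x y :: "'h \<Rightarrow> 'h::complex_inner"
  shows plus_comp: "(x + y) \<circ> z = (x \<circ> z) + (y \<circ> z)"
    and minus_comp: "(x - y) \<circ> z = (x \<circ> z) - (y \<circ> z)"
  by (simp_all add: fun_eq_iff)

lemma comp_plus: "clinear x \<Longrightarrow> x \<circ> (y + z) = (x \<circ> y) + (x \<circ> z)"
  and comp_minus: "clinear x \<Longrightarrow> x \<circ> (y - z) = (x \<circ> y) - (x \<circ> z)"
  and comp_zero: "clinear x \<Longrightarrow> x \<circ> 0 = 0"
  by (simp_all add: fun_eq_iff clinear_add clinear_diff clinear_zero)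

lemma cinner_add_left: "cinner (x + y) z = cinner x z + cinner y z"
  by (metis cinner_add_right cinner_commute complex_cnj_add)

lemma cinner_scaleC_left: "cinner (a *\<^sub>C x) y = cnj a * cinner x y"
  by (metis cinner_commute cinner_scaleC_right complex_cnj_mult)

lemma cinner_zero_right: "cinner x 0 = 0"
  using cinner_scaleC_right[of x 0 0] by simp

lemma cinner_diff_right: "cinner x (y - z) = cinner x y - cinner x z"
  by (metis add_diff_cancel_right' cinner_add_right diff_add_cancel)

lemma cinner_sum_right: "cinner x (sum f S) = (\<Sum>i\<in>S. cinner x (f i))"
  by (induction S rule: infinite_finite_induct) (simp_all add: cinner_zero_right cinner_add_right)

lemma cinner_eqI: "u = w" if "\<And>v. cinner v u = cinner v w"
  using that[of "u - w"] by (metis cinner_diff_right cinner_eq_zero_iff diff_self eq_iff_diff_eq_0)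

lemma cinner_eqI_left: "u = w" if "\<And>v. cinner u v = cinner w v"
  by (metis cinner_commute cinner_eqI that)

text \<open>Replaces the definite description: an adjoint is computed by exhibiting a linear
  candidate and checking the inner product identity.\<close>

lemma cadjoint_unique:
  assumes "clinear y" "\<And>u v. cinner (y u) v = cinner u (x v)"
  shows "cadjoint x = y"
  unfolding cadjoint_def
proof (rule the_equality)
  fix y' assume "clinear y' \<and> (\<forall>u v. cinner (y' u) v = cinner u (x v))"
  then show "y' = y" using assms by (intro ext cinner_eqI_left) simp
qed (use assms in auto)

section \<open>Riesz representation and existence of adjoints in finite dimension\<close>

locale findim_complex_inner =
  fixes B :: "'h::complex_inner set"
  assumes fd: "finite_dimensional_vector_space (scaleC :: complex \<Rightarrow> 'h \<Rightarrow> 'h) B"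
begin

lemma finite_B: "finite B" and independent_B: "\<not> complex_vector.dependent B"
  and span_B: "complex_vector.span B = UNIV"
  using finite_dimensional_vector_space.finite_Basis[OF fd]
    finite_dimensional_vector_space.independent_Basis[OF fd]
    finite_dimensional_vector_space.span_Basis[OF fd] by auto

lemma basis_expansion: "(\<Sum>b\<in>B. complex_vector.representation B u b *\<^sub>C b) = u"
  by (rule complex_vector.sum_representation_eq) (auto simp: finite_B independent_B span_B)

text \<open>The map sending \<open>w\<close> to \<open>\<Sum>b\<in>B. \<langle>b, w\<rangle> b\<close> is injective, hence onto; this replaces an
  orthonormal basis.\<close>

lemma riesz:
  assumes add: "\<And>u v. \<phi> (u + v) = \<phi> u + \<phi> v" and scale: "\<And>c u. \<phi> (c *\<^sub>C u) = c * \<phi> u"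
  shows "\<exists>w::'h. \<forall>v. \<phi> v = cinner w v"
proof -
  define T where "T w = (\<Sum>b\<in>B. cinner b w *\<^sub>C b)" for w
  have T: "clinear T"
    by (simp add: clinear_iff T_def cinner_add_right cinner_scaleC_right scaleC_add_left
        sum.distrib complex_vector.scale_sum_right scaleC_scaleC)
  \<comment> \<open>Independence of \<open>B\<close> allows coefficients to be compared, so
    \<open>T w\<close> determines every \<open>cinner b w\<close>.\<close>
  have coeffs: "cinner b w = f b" if "T w = (\<Sum>b\<in>B. f b *\<^sub>C b)" "b \<in> B" for w f b
  proof -
    have "(\<Sum>b\<in>B. (cinner b w - f b) *\<^sub>C b) = 0"
      using that(1) by (simp add: T_def complex_vector.scale_left_diff_distrib sum_subtractf)
    then have "cinner b w - f b = 0"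
      using independent_B complex_vector.dependent_finite[OF finite_B] that(2)
      by (auto dest!: spec[of _ "\<lambda>b. cinner b w - f b"])
    then show ?thesis by simp
  qed
  have "w = w'" if "T w = T w'" for w w'
  proof -
    have "T (w - w') = (\<Sum>b\<in>B. 0 *\<^sub>C b)" using that by (simp add: clinear_diff[OF T])
    then have z: "cinner b (w - w') = 0" if "b \<in> B" for b
      using coeffs[of "w - w'" "\<lambda>_. 0"] that by simp
    \<comment> \<open>A vector orthogonal to all of \<open>B\<close> is orthogonal to its own
      expansion in \<open>B\<close>, hence to itself.\<close>
    have "cinner (w - w') (w - w') = (\<Sum>b\<in>B. cinner (w - w') (complex_vector.representation B (w - w') b *\<^sub>C b))"
      by (simp flip: cinner_sum_right add: basis_expansion)
    also have "\<dots> = 0"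
      by (intro sum.neutral ballI) (metis cinner_commute cinner_scaleC_right complex_cnj_zero mult_zero_right z)
    finally show ?thesis by (simp add: cinner_eq_zero_iff)
  qed
  then have "inj T" by (auto intro: injI)
  then have "surj T"
    using finite_dimensional_vector_space.linear_inj_imp_surj[OF fd T] by blast
  \<comment> \<open>The conjugates compensate the antilinearity in the first argument:
    \<open>cinner b w = cnj (\<phi> b)\<close> means \<open>cinner w b = \<phi> b\<close>.\<close>
  then obtain w where w: "T w = (\<Sum>b\<in>B. cnj (\<phi> b) *\<^sub>C b)" by (metis surjD)
  have b: "cinner w b = \<phi> b" if "b \<in> B" for b
    using coeffs[OF w that] by (metis cinner_commute complex_cnj_cnj)
  have \<phi>_sum: "\<phi> (sum f S) = (\<Sum>i\<in>S. \<phi> (f i))" for f and S :: "'h set"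
    using scale[of 0 0] by (induction S rule: infinite_finite_induct) (simp_all add: add)
  have "\<phi> v = cinner w v" for v
  proof -
    let ?v = "\<Sum>b\<in>B. complex_vector.representation B v b *\<^sub>C b"
    have "\<phi> ?v = cinner w ?v" by (simp add: \<phi>_sum cinner_sum_right scale cinner_scaleC_right b)
    then show ?thesis by (simp add: basis_expansion)
  qed
  then show ?thesis by blast
qed

text \<open>For each \<open>u\<close> the Riesz vector of the functional sending \<open>v\<close> to
  \<open>cinner u (x v)\<close> serves as \<open>y u\<close>; uniqueness of that vector makes
  \<open>y\<close> linear.\<close>

lemma adjoint_exists:
  assumes x: "clinear (x :: 'h \<Rightarrow> 'h)"
  shows "\<exists>y. clinear y \<and> (\<forall>u v. cinner (y u) v = cinner u (x v))"
proof -
  have "\<exists>w. \<forall>v. cinner u (x v) = cinner w v" for u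
    by (rule riesz[where \<phi> = "\<lambda>v. cinner u (x v)"])
      (simp_all only: clinear_add[OF x] clinear_scale[OF x] cinner_add_right cinner_scaleC_right)
  then obtain y where y: "\<And>u v. cinner u (x v) = cinner (y u) v" by metis
  have "y (u + v) = y u + y v" "y (c *\<^sub>C u) = c *\<^sub>C y u" for u v c
    by (rule cinner_eqI_left, simp only: y[symmetric] cinner_add_left cinner_scaleC_left)+
  then have "clinear y" by (simp add: clinear_iff)
  then show ?thesis using y by metis
qed

lemma
  fixes x :: "'h \<Rightarrow> 'h"
  assumes "clinear x"
  shows clinear_cadjoint: "clinear (cadjoint x)"
    and cinner_cadjoint_left: "cinner (cadjoint x u) v = cinner u (x v)"
  using assms adjoint_exists cadjoint_unique by metis+

lemma cinner_cadjoint_right: "clinear x \<Longrightarrow> cinner u (cadjoint x v) = cinner (x u) v" for x :: "'h \<Rightarrow> 'h"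
  by (metis cinner_commute cinner_cadjoint_left)

lemma cadjoint_cadjoint: "clinear x \<Longrightarrow> cadjoint (cadjoint x) = x" for x :: "'h \<Rightarrow> 'h"
  by (rule cadjoint_unique) (simp_all add: cinner_cadjoint_right)

lemma cadjoint_comp:
  "clinear x \<Longrightarrow> clinear y \<Longrightarrow> cadjoint (x \<circ> y) = cadjoint y \<circ> cadjoint x" for x y :: "'h \<Rightarrow> 'h"
  by (rule cadjoint_unique) (simp_all add: clinear_comp clinear_cadjoint cinner_cadjoint_left)

lemma cadjoint_add:
  "clinear x \<Longrightarrow> clinear y \<Longrightarrow> cadjoint (x + y) = cadjoint x + cadjoint y" for x y :: "'h \<Rightarrow> 'h"
  by (rule cadjoint_unique)
    (simp_all add: clinear_plus clinear_cadjoint cinner_cadjoint_left cinner_add_left cinner_add_right)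

lemma cadjoint_scale_op:
  "clinear x \<Longrightarrow> cadjoint (scale_op c x) = scale_op (cnj c) (cadjoint x)" for x :: "'h \<Rightarrow> 'h"
  by (rule cadjoint_unique)
    (simp_all add: clinear_scale_op clinear_cadjoint cinner_cadjoint_left scale_op_apply
      cinner_scaleC_left cinner_scaleC_right)

lemma cadjoint_zero: "cadjoint 0 = (0 :: 'h \<Rightarrow> 'h)"
  by (rule cadjoint_unique) (simp_all add: clinear_zero_op cinner_zero_right, metis cinner_commute cinner_zero_right complex_cnj_zero)

text \<open>The squared norm of \<open>q u\<close> is the inner product of \<open>u\<close> with
  \<open>(cadjoint q \<circ> q) u\<close>. This positivity is what excludes nilpotents and oblique
  idempotents below.\<close>

lemma cadjoint_comp_eq_zero:
  assumes "clinear q" "cadjoint q \<circ> q = 0"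
  shows "q = (0 :: 'h \<Rightarrow> 'h)"
proof
  fix u
  have "cinner (q u) (q u) = cinner u ((cadjoint q \<circ> q) u)"
    by (simp add: cinner_cadjoint_right assms(1))
  then show "q u = 0 u" by (simp add: assms(2) cinner_zero_right cinner_eq_zero_iff)
qed

lemma clinear_ops_finitely_spanned:
  "\<exists>S. finite S \<and> (\<forall>x :: 'h \<Rightarrow> 'h. clinear x \<longrightarrow> x \<in> op_vector.span S)"
proof (intro exI conjI allI impI)
  let ?R = "complex_vector.representation B"
  \<comment> \<open>These are the matrix units: \<open>E b c\<close> sends the basis vector
    \<open>b\<close> to \<open>c\<close> and kills the other basis vectors.\<close>
  define E where "E b c u = ?R u b *\<^sub>C c" for b c u :: 'h
  show "finite ((\<lambda>(b, c). E b c) ` (B \<times> B))" using finite_B by simp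
  fix x :: "'h \<Rightarrow> 'h" assume x: "clinear x"
  have "x u = (\<Sum>b\<in>B. \<Sum>c\<in>B. scale_op (?R (x b) c) (E b c)) u" for u
  proof -
    have "x u = x (\<Sum>b\<in>B. ?R u b *\<^sub>C b)" by (simp add: basis_expansion)
    also have "\<dots> = (\<Sum>b\<in>B. ?R u b *\<^sub>C x b)"
      by (simp only: clinear_sum[OF x] clinear_scale[OF x])
    also have "\<dots> = (\<Sum>b\<in>B. ?R u b *\<^sub>C (\<Sum>c\<in>B. ?R (x b) c *\<^sub>C c))"
      by (simp only: basis_expansion)
    also have "\<dots> = (\<Sum>b\<in>B. \<Sum>c\<in>B. scale_op (?R (x b) c) (E b c)) u"
      by (simp add: sum_op_apply scale_op_apply E_def complex_vector.scale_sum_right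
          scaleC_scaleC mult.commute)
    finally show ?thesis .
  qed
  then have x_eq: "x = (\<Sum>b\<in>B. \<Sum>c\<in>B. scale_op (?R (x b) c) (E b c))" by blast
  have "(\<Sum>b\<in>B. \<Sum>c\<in>B. scale_op (?R (x b) c) (E b c)) \<in> op_vector.span ((\<lambda>(b, c). E b c) ` (B \<times> B))"
    by (intro op_vector.span_sum op_vector.span_scale op_vector.span_base) auto
  then show "x \<in> op_vector.span ((\<lambda>(b, c). E b c) ` (B \<times> B))" using x_eq by simp
qed

end

section \<open>Polynomials in an operator\<close>

text \<open>Horner evaluation of a polynomial at \<open>z\<close>, with composition as product and
  \<open>id\<close> as unit, since \<open>*\<close> on functions is pointwise.\<close>

definition op_poly :: "('h::complex_inner \<Rightarrow> 'h) \<Rightarrow> complex poly \<Rightarrow> 'h \<Rightarrow> 'h" where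
  "op_poly z p = fold_coeffs (\<lambda>a f. scale_op a id + (z \<circ> f)) p 0"

lemma op_poly_0: "op_poly z 0 = 0"
  by (simp add: op_poly_def)

lemma op_poly_pCons:
  "clinear z \<Longrightarrow> op_poly z (pCons a p) = scale_op a id + (z \<circ> op_poly z p)"
  \<comment> \<open>\<open>fold_coeffs\<close> gives its start value at
    \<open>pCons 0 0 = 0\<close>; the equation survives there because a linear \<open>z\<close>
    satisfies \<open>z \<circ> 0 = 0\<close>.\<close>
  by (cases "p = 0 \<and> a = 0") (auto simp: op_poly_def comp_zero)

lemma op_poly_add: "clinear z \<Longrightarrow> op_poly z (p + q) = op_poly z p + op_poly z q"
  by (induction p q rule: poly_induct2)
    (simp_all add: op_poly_0 op_poly_pCons comp_plus op_vector.scale_left_distrib)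

lemma op_poly_smult: "clinear z \<Longrightarrow> op_poly z (smult c p) = scale_op c (op_poly z p)"
  by (induction p)
    (simp_all add: op_poly_0 op_poly_pCons comp_scale_op op_vector.scale_right_distrib)

lemma op_poly_sum:
  "clinear z \<Longrightarrow> op_poly z (sum f S) = (\<Sum>i\<in>S. op_poly z (f i))"
  by (induction S rule: infinite_finite_induct) (simp_all add: op_poly_0 op_poly_add)

lemma clinear_op_poly: "clinear z \<Longrightarrow> clinear (op_poly z p)"
  by (induction p)
    (simp_all add: op_poly_0 op_poly_pCons clinear_zero_op clinear_plus clinear_scale_op clinear_id clinear_comp)

text \<open>On the range of \<open>q\<close> the operator \<open>z\<close> is multiplication by
  \<open>a\<close>, so a polynomial in \<open>z\<close> acts there by its value at
  \<open>a\<close>.\<close>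

lemma op_poly_eigen:
  assumes "clinear z" "z \<circ> q = scale_op a q"
  shows "op_poly z p \<circ> q = scale_op (poly p a) q"
proof (induction p)
  case (pCons c p)
  have "op_poly z (pCons c p) \<circ> q = scale_op c q + (z \<circ> (op_poly z p \<circ> q))"
    using assms(1) by (simp add: op_poly_pCons plus_comp scale_op_comp comp_assoc)
  also have "\<dots> = scale_op c q + scale_op (poly p a) (scale_op a q)"
    by (simp add: pCons comp_scale_op assms)
  finally show ?case by (simp add: op_vector.scale_left_distrib mult.commute)
qed (simp add: op_poly_0 fun_eq_iff scale_op_apply)

text \<open>Otherwise the powers of \<open>z\<close> would be independent, and
  \<open>card S + 1\<close> of them would lie in a space spanned by \<open>card S\<close>
  operators.\<close>

lemma (in findim_complex_inner) annihilating_poly: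
  assumes z: "clinear (z :: 'h \<Rightarrow> 'h)"
  shows "\<exists>p. p \<noteq> 0 \<and> op_poly z p = 0"
proof (rule ccontr)
  assume "\<not> ?thesis"
  then have nz: "p = 0" if "op_poly z p = 0" for p using that by blast
  obtain S :: "('h \<Rightarrow> 'h) set" where S: "finite S" "\<And>x. clinear x \<Longrightarrow> x \<in> op_vector.span S"
    using clinear_ops_finitely_spanned by blast
  define P where "P i = op_poly z (monom 1 i)" for i
  \<comment> \<open>Equal powers would give an annihilating difference of monomials. Injectivity
    ensures that \<open>?T\<close> really has \<open>card S + 1\<close> elements.\<close>
  have "P i - P j = op_poly z (monom 1 i - monom 1 j)" for i j
    using op_poly_add[OF z, of "monom 1 i - monom 1 j" "monom 1 j"] by (simp add: P_def)
  then have inj: "inj P"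
    by (intro injI) (metis diff_self eq_iff_diff_eq_0 nz monom_eq_iff' zero_neq_one)
  let ?T = "P ` {..card S}"
  have "\<not> op_vector.dependent ?T"
  proof
    assume "op_vector.dependent ?T"
    then obtain a v where v: "v \<in> ?T" "a v \<noteq> 0" "(\<Sum>v\<in>?T. scale_op (a v) v) = 0"
      by (auto simp: op_vector.dependent_finite)
    define p where "p = (\<Sum>i\<le>card S. monom (a (P i)) i)"
    have "op_poly z p = (\<Sum>i\<le>card S. scale_op (a (P i)) (P i))"
      by (simp add: p_def op_poly_sum[OF z] P_def smult_monom flip: op_poly_smult[OF z])
    also have "\<dots> = 0"
      using v(3) inj by (subst (asm) sum.reindex) (auto simp: inj_on_def)
    finally have "p = 0" by (rule nz)
    moreover from v(1) obtain i where "i \<le> card S" "v = P i" by auto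
    moreover from this have "coeff p i = a v"
      by (simp add: p_def coeff_sum)
    ultimately show False using v(2) by simp
  qed
  moreover have "?T \<subseteq> op_vector.span S" using S(2) by (auto simp: P_def clinear_op_poly[OF z])
  ultimately have "card ?T \<le> card S" using op_vector.independent_span_bound S(1) by blast
  then show False using inj by (simp add: card_image inj_on_subset)
qed

section \<open>Commutative involutive algebras of operators\<close>

locale comm_star_algebra = findim_complex_inner B for B :: "'h::complex_inner set" +
  fixes Z :: "('h \<Rightarrow> 'h) set"
  assumes Z_clinear: "x \<in> Z \<Longrightarrow> clinear x"
    and Z_id: "id \<in> Z"
    and Z_add: "x \<in> Z \<Longrightarrow> y \<in> Z \<Longrightarrow> x + y \<in> Z"
    and Z_scale: "x \<in> Z \<Longrightarrow> scale_op c x \<in> Z"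
    and Z_comp: "x \<in> Z \<Longrightarrow> y \<in> Z \<Longrightarrow> x \<circ> y \<in> Z"
    and Z_cadjoint: "x \<in> Z \<Longrightarrow> cadjoint x \<in> Z"
    and Z_commute: "x \<in> Z \<Longrightarrow> y \<in> Z \<Longrightarrow> x \<circ> y = y \<circ> x"
begin

lemma Z_zero: "0 \<in> Z"
  using Z_scale[OF Z_id, of 0] by simp

lemma Z_minus: "x \<in> Z \<Longrightarrow> y \<in> Z \<Longrightarrow> x - y \<in> Z"
  using Z_add[of x "scale_op (-1) y"] Z_scale[of y "-1"]
  by simp

lemma Z_op_poly: "z \<in> Z \<Longrightarrow> op_poly z p \<in> Z"
  by (induction p) (simp_all add: op_poly_0 op_poly_pCons Z_clinear Z_zero Z_add Z_scale Z_id Z_comp)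

text \<open>By commutativity \<open>h = cadjoint q \<circ> q\<close> also has square zero. As
  \<open>h\<close> is selfadjoint, positivity gives first \<open>h = 0\<close> and then
  \<open>q = 0\<close>.\<close>

lemma no_nilpotents:
  assumes q: "q \<in> Z" "q \<circ> q = 0"
  shows "q = 0"
proof -
  have lin: "clinear q" using q Z_clinear by blast
  define h where "h = cadjoint q \<circ> q"
  have "h \<circ> h = cadjoint q \<circ> cadjoint q \<circ> (q \<circ> q)"
    by (metis Z_cadjoint Z_commute comp_assoc h_def q(1))
  then have "h \<circ> h = 0"
    using q(2) by (simp add: comp_zero clinear_comp clinear_cadjoint lin)
  moreover have "cadjoint h = h" "clinear h"
    by (simp_all add: h_def cadjoint_comp cadjoint_cadjoint clinear_comp clinear_cadjoint lin)
  ultimately have "h = 0" using cadjoint_comp_eq_zero by metis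
  then show ?thesis using cadjoint_comp_eq_zero lin h_def by metis
qed

text \<open>With \<open>s\<close> the adjoint of \<open>p\<close>, the difference
  \<open>q = p - (s \<circ> p)\<close> satisfies \<open>cadjoint q \<circ> q = 0\<close>. Thus
  \<open>p\<close> equals \<open>s \<circ> p\<close>, which is selfadjoint.\<close>

lemma idempotent_is_projection:
  assumes p: "p \<in> Z" "p \<circ> p = p"
  shows "is_projection p"
proof -
  define s where "s = cadjoint p"
  have lin: "clinear p" "clinear s" using p Z_clinear Z_cadjoint by (auto simp: s_def)
  have s: "s \<circ> s = s" and comm: "p \<circ> s = s \<circ> p"
    using p cadjoint_comp[OF lin(1) lin(1)] Z_commute Z_cadjoint by (auto simp: s_def)
  have sp: "cadjoint (s \<circ> p) = s \<circ> p"
    by (metis cadjoint_cadjoint cadjoint_comp lin s_def)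
  define q where "q = p - (s \<circ> p)"
  have q: "clinear q" by (simp add: q_def clinear_minus clinear_comp lin)
  have "cadjoint p = cadjoint q + cadjoint (s \<circ> p)"
    by (subst cadjoint_add[symmetric]) (simp_all add: q clinear_comp lin, simp add: q_def)
  then have cq: "cadjoint q = s - (s \<circ> p)" by (metis add_diff_cancel_right' s_def sp)
  have "s \<circ> (s \<circ> p) = s \<circ> p" by (simp only: comp_assoc[symmetric] s)
  then have sq: "s \<circ> q = 0" by (simp add: q_def comp_minus lin)
  have "(s \<circ> p) \<circ> q = p \<circ> (s \<circ> q)" by (simp only: comm[symmetric] comp_assoc)
  then have "cadjoint q \<circ> q = 0"
    by (simp only: cq minus_comp sq comp_zero[OF lin(1)] diff_self)
  then have "q = 0" using q by (rule cadjoint_comp_eq_zero[rotated])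
  then have "p = s \<circ> p" by (simp add: q_def)
  then show ?thesis unfolding is_projection_def using lin p sp by metis
qed

text \<open>Take \<open>p \<noteq> 0\<close> of least degree with \<open>p(z) e = 0\<close> and write \<open>p = (X - l) r\<close>. Then \<open>q = r(z) e\<close> satisfies
  \<open>z q = l q\<close>, so \<open>q\<close> is a multiple of an idempotent below \<open>e\<close>, which is \<open>e\<close> by minimality.\<close>

lemma minimal_projection_scalar:
  assumes e: "minimal_projection_of Z e" and z: "z \<in> Z"
  shows "\<exists>c. z \<circ> e = scale_op c e"
proof -
  have eZ: "e \<in> Z" and e0: "e \<noteq> 0" and ee: "e \<circ> e = e"
    and min: "\<And>f. f \<in> Z \<Longrightarrow> is_projection f \<Longrightarrow> f \<circ> e = f \<Longrightarrow> f = 0 \<or> f = e"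
    using e by (auto simp: minimal_projection_of_def is_projection_def)
  have lin: "clinear z" using z Z_clinear by blast
  let ?N = "\<lambda>p. p \<noteq> 0 \<and> op_poly z p \<circ> e = 0"
  obtain p0 where "?N p0" using annihilating_poly[OF lin] by (metis zero_fun_apply comp_apply ext)
  then obtain p where p: "?N p" and least: "\<And>p'. ?N p' \<Longrightarrow> degree p \<le> degree p'"
    using ex_has_least_nat[of ?N p0 degree] by blast
  have "\<not> constant (poly p)"
  proof
    assume "constant (poly p)"
    then obtain a where a: "p = [:a:]" by (metis constant_degree degree_eq_zeroE)
    then have "scale_op a e = 0" using p by (auto simp: op_poly_pCons lin op_poly_0 comp_zero scale_op_comp)
    then show False using a p e0 by simp
  qed
  then obtain l where "poly p l = 0" using fundamental_theorem_of_algebra by blast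
  then obtain r where r: "p = [:-l, 1:] * r" by (metis dvdE poly_eq_0_iff_dvd)
  then have r0: "r \<noteq> 0" using p by auto
  have "degree p = degree [:-l, 1:] + degree r"
    unfolding r by (rule degree_mult_eq) (use r0 in auto)
  then have "degree r < degree p" by simp
  define q where "q = op_poly z r \<circ> e"
  \<comment> \<open>Otherwise \<open>r\<close> would annihilate \<open>e\<close> with a degree
    smaller than that of \<open>p\<close>.\<close>
  have q0: "q \<noteq> 0" using least[of r] r0 \<open>degree r < degree p\<close> by (auto simp: q_def)
  have qZ: "q \<in> Z" using z eZ by (simp add: q_def Z_op_poly Z_comp)
  have qe: "q \<circ> e = q" by (simp add: q_def comp_assoc ee)
  have "op_poly z p = (z \<circ> op_poly z r) - scale_op l (op_poly z r)"
    using op_poly_add[OF lin, of "smult (-l) r" "pCons 0 r"]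
    by (simp add: r op_poly_pCons lin op_poly_smult flip: smult_minus_left)
  then have "(z \<circ> q) - scale_op l q = 0"
    using p by (simp add: q_def minus_comp scale_op_comp comp_assoc)
  then have zq: "z \<circ> q = scale_op l q" by simp
  \<comment> \<open>Since \<open>e\<close> fixes \<open>q\<close>, \<open>q \<circ> q\<close> is
    \<open>r(z) q\<close>, which is \<open>c\<close> times \<open>q\<close>. If \<open>c\<close>
    were \<open>0\<close>, then \<open>q\<close> would be nilpotent; so \<open>q / c\<close> is a
    nonzero idempotent.\<close>
  define c where "c = poly r l"
  have "q \<circ> q = op_poly z r \<circ> q"
    using Z_commute[OF eZ qZ] by (simp add: q_def comp_assoc) (metis qe q_def comp_assoc)
  also have "\<dots> = scale_op c q" unfolding c_def by (rule op_poly_eigen[OF lin zq])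
  finally have qq: "q \<circ> q = scale_op c q" .
  then have c0: "c \<noteq> 0" using no_nilpotents[OF qZ] q0 by auto
  define f where "f = scale_op (1 / c) q"
  have fZ: "f \<in> Z" by (simp add: f_def Z_scale qZ)
  have "f \<circ> f = f"
    using qZ c0 by (simp add: f_def scale_op_comp comp_scale_op Z_clinear qq)
  moreover have "f \<circ> e = f" by (simp add: f_def scale_op_comp qe)
  moreover have "f \<noteq> 0" using q0 c0 by (simp add: f_def)
  ultimately have "f = e" using min fZ idempotent_is_projection by blast
  moreover have "z \<circ> f = scale_op l f" by (simp add: f_def comp_scale_op lin zq op_vector.scale_left_commute)
  ultimately show ?thesis by blast
qed

end

section \<open>The center of the complexification\<close>

text \<open>The short list of projections makes \<open>e\<close> and \<open>f = id - e\<close>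
  minimal. Each \<open>z\<close> is then scalar on both, and
  \<open>z = (z \<circ> e) + (z \<circ> f)\<close> gives its two coordinates.\<close>

lemma comm_star_algebra_two_projections:
  assumes Z: "comm_star_algebra B Z"
    and e: "e \<in> Z" "is_projection e" "e \<noteq> 0" "e \<noteq> id"
    and only: "\<And>f. f \<in> Z \<Longrightarrow> is_projection f \<Longrightarrow> f \<in> {0, e, id - e, id}"
  shows "is_C_plus_C Z"
    and "{f. minimal_projection_of Z f} = {e, id - e}"
proof -
  interpret comm_star_algebra B Z by (rule Z)
  define f where "f = id - e"
  have le: "clinear e" "e \<circ> e = e" "cadjoint e = e" using e by (auto simp: is_projection_def)
  have lf: "clinear f" by (simp add: f_def clinear_minus clinear_id le)
  have fZ: "f \<in> Z" by (simp add: f_def Z_minus Z_id e)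
  have ef: "e \<circ> f = 0" "f \<circ> e = 0" "f \<circ> f = f"
    by (simp_all add: f_def comp_minus minus_comp le clinear_minus clinear_id)
  have pf: "is_projection f" using fZ ef by (simp add: idempotent_is_projection)
  have f0: "f \<noteq> 0" using e(4) by (auto simp: f_def)
  have sum: "e + f = id" by (simp add: f_def)
  have cases: "g = 0 \<or> g = e \<or> g = f \<or> g = id" if "g \<in> Z" "is_projection g" for g
    using only[OF that] by (auto simp: f_def)
  have min_e: "minimal_projection_of Z e"
    using e ef f0 cases unfolding minimal_projection_of_def by (metis comp_id fun.map_id0 id_apply comp_apply eq_id_iff id_comp)
  have min_f: "minimal_projection_of Z f"
    using pf fZ ef f0 e cases unfolding minimal_projection_of_def by (metis id_comp sum add.right_neutral)
  have "\<not> minimal_projection_of Z id"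
    using e unfolding minimal_projection_of_def by (metis comp_id)
  then have "g = e \<or> g = f" if "minimal_projection_of Z g" for g
    using that cases[of g] by (auto simp: minimal_projection_of_def)
  then show "{f. minimal_projection_of Z f} = {e, id - e}"
    using min_e min_f by (auto simp flip: f_def)
  define \<phi> where "\<phi> = (\<lambda>(a, b). scale_op a e + scale_op b f)"
  have \<phi>: "\<phi> (a, b) = scale_op a e + scale_op b f" for a b by (simp add: \<phi>_def)
  \<comment> \<open>Composition with \<open>e\<close> or \<open>f\<close> recovers a coordinate;
    this yields injectivity of \<open>\<phi>\<close>.\<close>
  have \<phi>e: "\<phi> (a, b) \<circ> e = scale_op a e" and \<phi>f: "\<phi> (a, b) \<circ> f = scale_op b f" for a b
    by (simp_all add: \<phi> plus_comp scale_op_comp ef le)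
  have "bij_betw \<phi> UNIV Z"
    unfolding bij_betw_def
  proof
    show "inj \<phi>"
    proof (rule injI, clarify)
      fix a b c d assume "\<phi> (a, b) = \<phi> (c, d)"
      then have "scale_op a e = scale_op c e" "scale_op b f = scale_op d f"
        by (metis \<phi>e, metis \<phi>f)
      then show "a = c \<and> b = d" using e(3) f0 by simp
    qed
    show "range \<phi> = Z"
    proof
      show "range \<phi> \<subseteq> Z" using e(1) fZ by (auto simp: \<phi> Z_add Z_scale)
      show "Z \<subseteq> range \<phi>"
      proof
        fix z assume z: "z \<in> Z"
        obtain a b where "z \<circ> e = scale_op a e" "z \<circ> f = scale_op b f"
          using minimal_projection_scalar min_e min_f z by metis
        then have "z = \<phi> (a, b)"
          using comp_plus[OF Z_clinear[OF z], of e f] by (simp add: \<phi> sum)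
        then show "z \<in> range \<phi>" by blast
      qed
    qed
  qed
  moreover have "\<phi> (a + c, b + d) = \<phi> (a, b) + \<phi> (c, d)" for a b c d
    by (simp add: \<phi> op_vector.scale_left_distrib)
  moreover have "\<phi> (c * a, c * b) = scale_op c (\<phi> (a, b))" for a b c
    by (simp add: \<phi> op_vector.scale_right_distrib)
  moreover have "\<phi> (a * c, b * d) = \<phi> (a, b) \<circ> \<phi> (c, d)" for a b c d
    by (simp add: \<phi> plus_comp scale_op_comp comp_plus comp_scale_op le lf ef
        clinear_plus clinear_scale_op)
  moreover have "\<phi> (1, 1) = id" by (simp add: \<phi> sum)
  moreover have "\<phi> (cnj a, cnj b) = cadjoint (\<phi> (a, b))" for a b
    using pf le lf by (simp add: \<phi> cadjoint_add cadjoint_scale_op clinear_scale_op is_projection_def)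
  ultimately show "is_C_plus_C Z" unfolding is_C_plus_C_def by blast
qed

section \<open>From the real algebra to its complex span\<close>

lemma clinear_span:
  assumes "\<forall>a\<in>A. clinear a" "x \<in> op_vector.span A"
  shows "clinear x"
proof -
  have "op_vector.subspace {x. clinear x}"
    by (simp add: op_vector.subspace_def clinear_zero_op clinear_plus clinear_scale_op)
  then show ?thesis using op_vector.span_minimal[of A "{x. clinear x}"] assms by blast
qed

lemma zero_comp: "0 \<circ> x = (0 :: 'h \<Rightarrow> 'h::complex_inner)"
  by (simp add: fun_eq_iff)

lemma commute_span:
  assumes y: "clinear y" "\<forall>a\<in>A. y \<circ> a = a \<circ> y" and x: "x \<in> op_vector.span A"
  shows "y \<circ> x = x \<circ> y"
proof -
  let ?C = "{x. y \<circ> x = x \<circ> y}"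
  have "op_vector.subspace ?C"
    using y(1) by (simp add: op_vector.subspace_def comp_zero zero_comp comp_plus plus_comp
        comp_scale_op scale_op_comp)
  then show ?thesis using op_vector.span_minimal[of A ?C] y(2) x by blast
qed

context findim_complex_inner
begin

text \<open>Bilinearity in two stages: the left factor is extended to the span for each right factor
  in \<open>A\<close>, then the right factor is extended for a fixed left factor in the
  span.\<close>

lemma span_comp:
  assumes A: "real_involutive_algebra (A :: ('h \<Rightarrow> 'h) set)"
    and x: "x \<in> op_vector.span A" and y: "y \<in> op_vector.span A"
  shows "x \<circ> y \<in> op_vector.span A"
proof -
  let ?S = "op_vector.span A"
  have lin: "clinear x" using A x clinear_span by (auto simp: real_involutive_algebra_def)
  have "x \<circ> a \<in> ?S" if a: "a \<in> A" for a
  proof -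
    have "op_vector.subspace {x. x \<circ> a \<in> ?S}"
      by (simp add: op_vector.subspace_def zero_comp plus_comp scale_op_comp
          op_vector.span_zero op_vector.span_add op_vector.span_scale)
    moreover have "A \<subseteq> {x. x \<circ> a \<in> ?S}"
      using A a by (auto simp: real_involutive_algebra_def intro: op_vector.span_base)
    ultimately show ?thesis using op_vector.span_minimal x by blast
  qed
  moreover have "op_vector.subspace {y. x \<circ> y \<in> ?S}"
    by (simp add: op_vector.subspace_def comp_zero comp_plus comp_scale_op lin
        op_vector.span_zero op_vector.span_add op_vector.span_scale)
  ultimately show ?thesis using op_vector.span_minimal[of A "{y. x \<circ> y \<in> ?S}"] y by blast
qed

lemma span_cadjoint:
  assumes A: "real_involutive_algebra (A :: ('h \<Rightarrow> 'h) set)" and x: "x \<in> op_vector.span A"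
  shows "cadjoint x \<in> op_vector.span A"
proof -
  let ?T = "{x. clinear x \<and> cadjoint x \<in> op_vector.span A}"
  have "op_vector.subspace ?T"
    by (simp add: op_vector.subspace_def clinear_zero_op clinear_plus clinear_scale_op
        cadjoint_zero cadjoint_add cadjoint_scale_op
        op_vector.span_zero op_vector.span_add op_vector.span_scale)
  moreover have "A \<subseteq> ?T"
    using A by (auto simp: real_involutive_algebra_def intro: op_vector.span_base)
  ultimately show ?thesis using op_vector.span_minimal x by blast
qed

lemma op_center_comm_star_algebra:
  assumes A: "real_involutive_algebra (A :: ('h \<Rightarrow> 'h) set)"
  shows "comm_star_algebra B (op_center (op_vector.span A))"
proof (intro comm_star_algebra.intro comm_star_algebra_axioms.intro)
  show "findim_complex_inner B" by (rule findim_complex_inner_axioms)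
next
  let ?S = "op_vector.span A"
  have "\<forall>a\<in>A. clinear a" using A by (simp add: real_involutive_algebra_def)
  then have lin: "clinear x" if "x \<in> ?S" for x using that clinear_span by blast
  fix x y assume x: "x \<in> op_center ?S"
  then have xS: "x \<in> ?S" and xc: "\<And>s. s \<in> ?S \<Longrightarrow> x \<circ> s = s \<circ> x" by (auto simp: op_center_def)
  show "clinear x" using lin xS .
  show "scale_op c x \<in> op_center ?S" for c
    using xS xc by (auto simp: op_center_def op_vector.span_scale scale_op_comp comp_scale_op lin)
  show "cadjoint x \<in> op_center ?S"
  proof -
    have "cadjoint x \<circ> s = s \<circ> cadjoint x" if s: "s \<in> ?S" for s
    proof -
      \<comment> \<open>The span is closed under adjoints, so \<open>x\<close> commutes with
        \<open>cadjoint s\<close>; taking adjoints makes \<open>cadjoint x\<close> commute with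
        \<open>s\<close>.\<close>
      have "cadjoint (cadjoint s \<circ> x) = cadjoint (x \<circ> cadjoint s)"
        using xc[OF span_cadjoint[OF A s]] by simp
      then show ?thesis
        using lin[OF xS] lin[OF s] by (simp add: cadjoint_comp cadjoint_cadjoint clinear_cadjoint)
    qed
    then show ?thesis using span_cadjoint[OF A xS] by (auto simp: op_center_def)
  qed
  assume y: "y \<in> op_center ?S"
  then have yS: "y \<in> ?S" and yc: "\<And>s. s \<in> ?S \<Longrightarrow> y \<circ> s = s \<circ> y" by (auto simp: op_center_def)
  show "x + y \<in> op_center ?S"
    using xS yS xc yc by (auto simp: op_center_def op_vector.span_add plus_comp comp_plus lin)
  show "x \<circ> y \<in> op_center ?S"
  proof -
    have "x \<circ> y \<circ> s = s \<circ> (x \<circ> y)" if "s \<in> ?S" for s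
      using xc[OF that] yc[OF that] by (metis comp_assoc)
    then show ?thesis using span_comp[OF A xS yS] by (auto simp: op_center_def)
  qed
  show "x \<circ> y = y \<circ> x" using xc yS by blast
next
  show "id \<in> op_center (op_vector.span A)"
    using A by (simp add: op_center_def real_involutive_algebra_def op_vector.span_base)
qed

section \<open>Conjugation by \<open>J\<close> and projections of the center\<close>

lemma antiunitary_conj_projection:
  assumes J: "antiunitary (J :: 'h \<Rightarrow> 'h)" "J \<circ> J = id" and e: "is_projection e"
  shows "is_projection (J \<circ> e \<circ> J)"
proof -
  have JJ: "J (J u) = u" for u using J(2) by (simp add: fun_eq_iff)
  have Ja: "J (u + v) = J u + J v" "J (c *\<^sub>C u) = cnj c *\<^sub>C J u"
    "cinner (J u) (J v) = cinner v u" for u v c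
    using J(1) by (auto simp: antiunitary_def)
  have le: "clinear e" "cadjoint e = e" "e (e u) = e u" for u
    using e by (auto simp: is_projection_def fun_eq_iff)
  have lin: "clinear (J \<circ> e \<circ> J)"
    unfolding clinear_iff by (simp add: Ja clinear_add clinear_scale le)
  \<comment> \<open>Moving \<open>J\<close> across reverses the inner product; this happens twice,
    so selfadjointness of \<open>e\<close> carries over.\<close>
  have "cinner (J (e (J u))) v = cinner u (J (e (J v)))" for u v
  proof -
    have "cinner (J (e (J u))) v = cinner (J v) (e (J u))" by (metis Ja(3) JJ)
    also have "\<dots> = cinner (e (J v)) (J u)" by (metis cinner_cadjoint_left le(1,2))
    also have "\<dots> = cinner u (J (e (J v)))" by (metis Ja(3) JJ)
    finally show ?thesis .
  qed
  then have "cadjoint (J \<circ> e \<circ> J) = J \<circ> e \<circ> J" using lin by (intro cadjoint_unique) auto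
  then show ?thesis using lin by (simp add: is_projection_def fun_eq_iff JJ le)
qed

text \<open>The adjoint and \<open>J\<close> are both antilinear, so \<open>opposite J\<close> is
  complex linear on linear operators. Commutation with opposites therefore extends from
  \<open>A\<close> to its complex span.\<close>

lemma opposite_commutes_span:
  assumes J: "antiunitary (J :: 'h \<Rightarrow> 'h)"
    and A: "\<forall>a\<in>A. clinear a"
    and order_zero: "\<forall>x\<in>A. \<forall>y\<in>A. x \<circ> opposite J y = opposite J y \<circ> x"
    and y: "y \<in> op_vector.span A" and x: "x \<in> A"
  shows "x \<circ> opposite J y = opposite J y \<circ> x"
proof -
  have J0: "J 0 = 0" using J unfolding antiunitary_def by (metis add_cancel_right_left)
  have lin: "clinear x" using A x by blast
  have J_lin: "J (u + v) = J u + J v" "J (c *\<^sub>C u) = cnj c *\<^sub>C J u" for u v c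
    using J by (auto simp: antiunitary_def)
  have opp_zero: "opposite J 0 = 0"
    by (simp add: opposite_def cadjoint_zero fun_eq_iff J0)
  have opp_add: "opposite J (a + b) = opposite J a + opposite J b" if "clinear a" "clinear b" for a b
    using that by (simp add: opposite_def cadjoint_add fun_eq_iff J_lin)
  have opp_scale: "opposite J (scale_op c a) = scale_op c (opposite J a)" if "clinear a" for c a
    using that by (simp add: opposite_def cadjoint_scale_op fun_eq_iff scale_op_apply J_lin)
  let ?T = "{y. clinear y \<and> x \<circ> opposite J y = opposite J y \<circ> x}"
  have "op_vector.subspace ?T"
    by (simp add: op_vector.subspace_def clinear_zero_op clinear_plus clinear_scale_op
        opp_zero opp_add opp_scale comp_zero zero_comp comp_plus plus_comp
        comp_scale_op scale_op_comp lin)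
  moreover have "A \<subseteq> ?T" using A order_zero x by auto
  ultimately show ?thesis using op_vector.span_minimal y by blast
qed

lemma center_projection_cases:
  assumes J: "antiunitary (J :: 'h \<Rightarrow> 'h)" "J \<circ> J = id"
    and A: "real_involutive_algebra A"
    and order_zero: "\<forall>x\<in>A. \<forall>y\<in>A. x \<circ> opposite J y = opposite J y \<circ> x"
    and irreducible: "irreducible_rep A J"
    and e: "e \<in> op_center (op_vector.span A)" "is_projection e"
  shows "e = 0 \<or> e = id \<or> J \<circ> e \<circ> J = id - e"
proof -
  define f where "f = J \<circ> e \<circ> J"
  have A_lin: "\<forall>a\<in>A. clinear a" using A by (simp add: real_involutive_algebra_def)
  have JJ: "J (J u) = u" for u using J(2) by (simp add: fun_eq_iff)
  have J_add: "J (u + v) = J u + J v" for u v using J(1) by (simp add: antiunitary_def)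
  have invJ: "inv J = J" using J(2) by (metis inv_unique_comp)
  have pf: "is_projection f" unfolding f_def by (rule antiunitary_conj_projection[OF J e(2)])
  have pe: "clinear e" "e \<circ> e = e" "cadjoint e = e" and pf': "clinear f" "f \<circ> f = f" "cadjoint f = f"
    using e(2) pf by (auto simp: is_projection_def)
  have eA: "e \<circ> a = a \<circ> e" if "a \<in> A" for a
    using e(1) that by (simp add: op_center_def op_vector.span_base)
  have "opposite J e = f" by (simp add: opposite_def pe invJ f_def)
  then have fA: "f \<circ> a = a \<circ> f" if "a \<in> A" for a
    using opposite_commutes_span[OF J(1) A_lin order_zero _ that, of e] e(1)
    by (simp add: op_center_def)
  have fe: "f \<circ> e = e \<circ> f"
    using commute_span[OF pf'(1), of A e] fA e(1) by (simp add: op_center_def)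
  \<comment> \<open>\<open>J\<close> exchanges \<open>e\<close> and \<open>f\<close>, hence commutes
    with their product and their sum, the two projections to which irreducibility is
    applied.\<close>
  have Jf: "J \<circ> f = e \<circ> J" and Je: "J \<circ> e = f \<circ> J"
    by (simp_all add: f_def fun_eq_iff JJ)
  have irr: "g = 0 \<or> g = id"
    if "is_projection g" "\<And>a. a \<in> A \<Longrightarrow> g \<circ> a = a \<circ> g" "g \<circ> J = J \<circ> g" for g
    using irreducible that unfolding irreducible_rep_def by blast
  define m where "m = e \<circ> f"
  have m: "clinear m" "cadjoint m = m" "m \<circ> m = m" "m \<circ> J = J \<circ> m"
    by (simp_all add: m_def clinear_comp pe pf' cadjoint_comp fe)
      (metis comp_assoc fe pe(2) pf'(2), metis comp_assoc fe Je Jf)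
  have mA: "m \<circ> a = a \<circ> m" if "a \<in> A" for a
    unfolding m_def using eA[OF that] fA[OF that] by (metis comp_assoc)
  have em: "e \<circ> m = m" unfolding m_def by (metis comp_assoc pe(2))
  from irr[of m] m mA have "m = 0 \<or> m = id" by (auto simp: is_projection_def)
  then show ?thesis
  proof
    assume "m = id"
    then have "e = id" using em by simp
    then show ?thesis by simp
  next
    assume m0: "m = 0"
    have ef0: "e \<circ> f = 0" "f \<circ> e = 0" using m0 by (simp_all add: m_def fe)
    have "is_projection (e + f)"
      by (simp add: is_projection_def clinear_plus pe pf' cadjoint_add plus_comp comp_plus ef0)
    moreover have "(e + f) \<circ> a = a \<circ> (e + f)" if "a \<in> A" for a
      using eA fA A_lin that by (simp add: plus_comp comp_plus)
    moreover have "(e + f) \<circ> J = J \<circ> (e + f)"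
      by (auto simp: fun_eq_iff J_add f_def JJ add.commute)
    ultimately have "e + f = 0 \<or> e + f = id" by (rule irr)
    then show ?thesis
    proof
      assume "e + f = 0"
      then have "e = 0" using comp_plus[OF pe(1), of e f] by (simp add: pe ef0 comp_zero)
      then show ?thesis by simp
    next
      assume "e + f = id"
      then show ?thesis by (simp add: f_def eq_diff_eq add.commute)
    qed
  qed
qed

end

theorem lemma2p2:
  fixes J :: "'h::complex_inner \<Rightarrow> 'h" and A :: "('h \<Rightarrow> 'h) set"
  assumes fin_dim: "\<exists>B. finite_dimensional_vector_space (scaleC :: complex \<Rightarrow> 'h \<Rightarrow> 'h) B"
    and nonzero: "\<exists>v::'h. v \<noteq> 0"
    and J: "antiunitary J" "J \<circ> J = id"
    and A: "real_involutive_algebra A"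
    and order_zero: "\<forall>x\<in>A. \<forall>y\<in>A. x \<circ> opposite J y = opposite J y \<circ> x"
    and separating: "has_separating_vector A"
    and irreducible: "irreducible_rep A J"
  shows "op_center (complexification A) = range (\<lambda>c. scale_op c id) \<or>
         (is_C_plus_C (op_center (complexification A)) \<and>
          (\<exists>e1 e2. e1 \<noteq> e2 \<and>
             {e. minimal_projection_of (op_center (complexification A)) e} = {e1, e2} \<and>
             J \<circ> e1 \<circ> inv J = e2))"
proof -
  obtain B where "finite_dimensional_vector_space (scaleC :: complex \<Rightarrow> 'h \<Rightarrow> 'h) B"
    using fin_dim by blast
  then interpret findim_complex_inner B by (rule findim_complex_inner.intro)
  define Z where "Z = op_center (complexification A)"
  interpret comm_star_algebra B Z
    unfolding Z_def by (rule op_center_comm_star_algebra[OF A])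
  have invJ: "inv J = J" using J(2) by (metis inv_unique_comp)
  have dich: "e = 0 \<or> e = id \<or> J \<circ> e \<circ> J = id - e" if "e \<in> Z" "is_projection e" for e
    using center_projection_cases[OF J A order_zero irreducible] that by (simp add: Z_def)
  show ?thesis
  proof (cases "\<forall>e\<in>Z. is_projection e \<longrightarrow> e = 0 \<or> e = id")
    case True
    \<comment> \<open>Here \<open>id\<close> is itself a minimal projection, so every element of
      \<open>Z\<close> is a scalar.\<close>
    have "(id :: 'h \<Rightarrow> 'h) \<noteq> 0" using nonzero by (auto simp: fun_eq_iff)
    then have "minimal_projection_of Z id"
      using True Z_id by (auto simp: minimal_projection_of_def intro: idempotent_is_projection)
    then have "Z \<subseteq> range (\<lambda>c. scale_op c id)" using minimal_projection_scalar by fastforce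
    moreover have "range (\<lambda>c. scale_op c id) \<subseteq> Z" using Z_id Z_scale by blast
    ultimately show ?thesis unfolding Z_def by blast
  next
    case False
    then obtain e where e: "e \<in> Z" "is_projection e" "e \<noteq> 0" "e \<noteq> id" by blast
    have Je: "J \<circ> e \<circ> J = id - e" using dich e by blast
    have JJ: "J (J u) = u" for u using J(2) by (simp add: fun_eq_iff)
    have "J (u - v) = J u - J v" for u v
      using J(1) unfolding antiunitary_def by (metis add_diff_cancel_right' diff_add_cancel)
    then have Je': "J \<circ> (id - e) \<circ> J = id - (id - e)"
      using Je by (simp add: fun_eq_iff JJ)
    \<comment> \<open>For nonzero \<open>f\<close> below \<open>g\<close>, the product
      \<open>(id - f) \<circ> (id - g)\<close> is evaluated twice: conjugating
      \<open>f \<circ> g = f\<close> by \<open>J\<close> gives \<open>id - f\<close>, expanding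
      gives \<open>id - g\<close>. The hypotheses on \<open>g\<close> hold for both \<open>e\<close>
      and \<open>id - e\<close>.\<close>
    have below: "f \<in> {0, g}"
      if "g \<noteq> id" "J \<circ> g \<circ> J = id - g" "f \<in> Z" "f \<circ> f = f" "f \<circ> g = f" for f g
    proof (cases "f = 0")
      case False
      have "f \<noteq> id" using that by auto
      then have Jf: "J \<circ> f \<circ> J = id - f"
        using dich[of f] idempotent_is_projection that False by blast
      have "(J \<circ> f \<circ> J) \<circ> (J \<circ> g \<circ> J) = J \<circ> (f \<circ> g) \<circ> J"
        using J(2) by (simp add: fun_eq_iff)
      then have "(id - f) \<circ> (id - g) = id - f" using Jf that by simp
      moreover have "(id - f) \<circ> (id - g) = id - g"
        using that Z_clinear by (simp add: minus_comp comp_minus)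
      ultimately show ?thesis by simp
    qed simp
    have ee: "e \<circ> e = e" and le: "clinear e" using e by (auto simp: is_projection_def)
    have e': "id - e \<in> Z" "(id - e) \<circ> (id - e) = id - e" "id - e \<noteq> id"
      using e by (auto simp: Z_minus Z_id minus_comp comp_minus le ee)
    have "f \<in> {0, e, id - e, id}" if f: "f \<in> Z" "is_projection f" for f
    proof -
      have lf: "clinear f" and ff: "f \<circ> f = f" using f by (auto simp: is_projection_def)
      \<comment> \<open>The parts of \<open>f\<close> under \<open>e\<close> and under
        \<open>id - e\<close> are idempotents of \<open>Z\<close>, so \<open>below\<close> leaves
        two values for each and four for their sum \<open>f\<close>.\<close>
      have restrict: "f \<circ> g \<circ> (f \<circ> g) = f \<circ> g" if "g \<in> Z" "g \<circ> g = g" for g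
        using Z_commute[OF f(1) that(1)] ff that(2) by (metis comp_assoc)
      have "f \<circ> e \<in> {0, e}"
        using below[OF e(4) Je Z_comp[OF f(1) e(1)] restrict[OF e(1) ee]] by (simp add: comp_assoc ee)
      moreover have "f \<circ> (id - e) \<in> {0, id - e}"
        using below[OF e'(3) Je' Z_comp[OF f(1) e'(1)] restrict[OF e'(1,2)]]
        by (simp add: comp_assoc e'(2))
      moreover have "f = (f \<circ> e) + (f \<circ> (id - e))" by (simp add: comp_minus lf)
      ultimately show ?thesis by auto
    qed
    note two = comm_star_algebra_two_projections[OF comm_star_algebra_axioms e this]
    \<comment> \<open>The two minimal projections are distinct: equality would give
      \<open>e = e \<circ> (id - e) = 0\<close>.\<close>
    have "e \<noteq> id - e"
    proof
      assume "e = id - e"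
      then have "e = e \<circ> (id - e)" using ee by simp
      then show False using e(3) by (simp add: comp_minus le ee)
    qed
    then show ?thesis using two Je invJ unfolding Z_def[symmetric] by metis
  qed
qed

end
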